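(* Let $C\subset[0,1]$ be the middle-third Cantor set. Then $$\frac1C+\frac1C+\frac1C+\frac1C=\Big\{\frac1{x_1}+\frac1{x_2}+\frac1{x_3}+\frac1{x_4}:x_i\in C\setminus\{0\},\ 1\le i\le4\Big\}=[4,\infty).$$ Namely, for any $a\in[4,\infty)$ there exist $x_1,x_2,x_3,x_4\in C\setminus\{0\}$ with $a=\frac1{x_1}+\frac1{x_2}+\frac1{x_3}+\frac1{x_4}$. Moreover, the result is sharp in the sense that neither $\frac1C+\frac1C+\frac1C$ nor $\frac1C+\frac1C$ is an interval.
   Context: For $m\ge1$, the $m$-fold sum $\frac1C+\cdots+\frac1C$ denotes $\{\frac1{x_1}+\cdots+\frac1{x_m}:x_i\in C\setminus\{0\}\}$. *)

theory Defs
  imports "HOL-Analysis.Analysis"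
begin

(* cantor_stage n is what remains of [0,1] after n rounds of deleting open middle thirds:
   a union of 2^n closed intervals of length 3^(-n).  Deleting the middle third of [0,1] first
   and then carrying out n rounds in each of [0,1/3] and [2/3,1] leaves two copies of stage n,
   scaled by 1/3. *)
primrec cantor_stage :: "nat \<Rightarrow> real set" where
  "cantor_stage 0 = {0..1}"
| "cantor_stage (Suc n) =
     (\<lambda>x. x / 3) ` cantor_stage n \<union> (\<lambda>x. 2 / 3 + x / 3) ` cantor_stage n"

definition cantor_set :: "real set" where
  "cantor_set = (\<Inter>n. cantor_stage n)"

(* The m-fold sum 1/S + ... + 1/S; only the values x i with i < m matter. *)
definition recip_sumset :: "nat \<Rightarrow> real set \<Rightarrow> real set" where
  "recip_sumset m S = {(\<Sum>i<m. 1 / x i) | x :: nat \<Rightarrow> real. \<forall>i<m. x i \<in> S - {0}}"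

end

theory Submission
  imports Defs
begin

text \<open>
  Every nonzero point of the Cantor set is \<open>x / 3 ^ k\<close> with \<open>x\<close> in the right half
  \<open>R = C \<inter> [2/3, 1]\<close>, so \<open>1/C\<close> is the union of the sets \<open>3 ^ k \<cdot> (1/R)\<close>, and \<open>1/R\<close> lies in
  \<open>[1, 3/2]\<close>.  The point is that sums of four scaled copies of \<open>1/R\<close> have no gaps:
  for the weights \<open>(1,1,1,1)\<close>, \<open>(3,1,1,1)\<close> and \<open>(3,3,1,1)\<close> they are the full intervals
  \<open>[4, 6]\<close>, \<open>[6, 9]\<close> and \<open>[8, 12]\<close> (\<open>weighted_recip_sum_full\<close>).  These three cover \<open>[4, 12]\<close>, and
  multiplication by powers of \<open>3\<close> carries \<open>[4, 12]\<close> over all of \<open>[4, \<infinity>)\<close>.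

  That there are no gaps is a thickness argument in the spirit of Newhouse.  Approximate each
  summand by \<open>w / y\<close> with \<open>y\<close> ranging over an interval \<open>[a, a + h]\<close> that occurs in the
  construction of \<open>R\<close>.  Deleting the middle third of one of these intervals opens a gap in its
  image, but as long as the images of the other three intervals have total length at least that of
  the gap, the sum of the four does not change (\<open>refine_summand\<close>).  The map \<open>y \<mapsto> 1 / y\<close> distorts
  lengths on \<open>[2/3, 1]\<close> by a factor between \<open>1\<close> and \<open>9/4\<close> only, so this condition holds
  at every stage if the four intervals are refined in turn, those of larger weight first.
  Compactness of \<open>R\<close> finishes the argument.

  For sharpness, a point of \<open>1/C\<close> is either at most \<open>3/2\<close> or at least \<open>3\<close>.  Hence an \<open>m\<close>-fold
  sum is at most \<open>3 m / 2\<close> or at least \<open>m + 2\<close>, and for \<open>m < 4\<close> these bounds leave a gap.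
\<close>

section \<open>The Cantor set\<close>

lemma cantor_set_bounds: "x \<in> cantor_set \<Longrightarrow> 0 \<le> x \<and> x \<le> 1"
  unfolding cantor_set_def by (drule INT_D[of _ _ _ 0]) auto

lemma cantor_set_gap: "x \<in> cantor_set \<Longrightarrow> x \<le> 1/3 \<or> 2/3 \<le> x"
  unfolding cantor_set_def by (drule INT_D[of _ _ _ 1]) auto

lemma cantor_set_left_third:
  assumes "x \<in> cantor_set" shows "x / 3 \<in> cantor_set"
proof -
  have "x / 3 \<in> cantor_stage n" for n
    using assms cantor_set_bounds[OF assms] by (cases n) (auto simp: cantor_set_def)
  then show ?thesis by (simp add: cantor_set_def)
qed

lemma cantor_set_right_third:
  assumes "x \<in> cantor_set" shows "2 / 3 + x / 3 \<in> cantor_set"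
proof -
  have "2 / 3 + x / 3 \<in> cantor_stage n" for n
    using assms cantor_set_bounds[OF assms] by (cases n) (auto simp: cantor_set_def)
  then show ?thesis by (simp add: cantor_set_def)
qed

lemma cantor_set_div_power_3: "x \<in> cantor_set \<Longrightarrow> x / 3 ^ n \<in> cantor_set"
proof (induction n)
  case (Suc n)
  then show ?case using cantor_set_left_third[of "x / 3 ^ n"] by (simp add: mult.commute)
qed simp

lemma zero_in_cantor_set: "0 \<in> cantor_set"
proof -
  have "0 \<in> cantor_stage n" for n by (induction n) (auto simp: image_iff)
  then show ?thesis by (simp add: cantor_set_def)
qed

lemma one_in_cantor_set: "1 \<in> cantor_set"
proof -
  have "1 \<in> cantor_stage n" for n by (induction n) (auto intro: rev_image_eqI[of 1])
  then show ?thesis by (simp add: cantor_set_def)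
qed

lemma compact_cantor_set: "compact cantor_set"
proof -
  have "compact (cantor_stage n)" for n
    by (induction n) (auto intro!: compact_Un compact_continuous_image continuous_intros)
  then show ?thesis unfolding cantor_set_def by (intro compact_Inter) auto
qed

section \<open>Sums of four reciprocals without gaps\<close>

text \<open>
  The left endpoint \<open>a\<close> and length \<open>h\<close> of an interval of the construction that lies in
  \<open>[2/3, 1]\<close>.  Requiring a scaled copy of the whole Cantor set, and not just the endpoints, makes
  the property pass to both outer thirds.
\<close>

definition cantor_copy :: "real \<Rightarrow> real \<Rightarrow> bool" where
  "cantor_copy h a \<longleftrightarrow> 2 / 3 \<le> a \<and> (\<forall>x\<in>cantor_set. a + h * x \<in> cantor_set)"

lemma cantor_copyD:
  assumes "cantor_copy h a"
  shows "2 / 3 \<le> a" "a \<in> cantor_set" "a + h \<le> 1"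
  using assms zero_in_cantor_set one_in_cantor_set cantor_set_bounds[of "a + h"]
  by (force simp: cantor_copy_def)+

lemma cantor_copy_left: "cantor_copy h a \<Longrightarrow> cantor_copy (h / 3) a"
  using cantor_set_left_third by (fastforce simp: cantor_copy_def)

lemma cantor_copy_right:
  assumes "cantor_copy h a" "0 < h" shows "cantor_copy (h / 3) (a + 2 * h / 3)"
proof -
  have "a + 2 * h / 3 + h / 3 * x \<in> cantor_set" if "x \<in> cantor_set" for x
  proof -
    have "a + h * (2 / 3 + x / 3) \<in> cantor_set"
      using assms cantor_set_right_third[OF that] by (simp add: cantor_copy_def)
    then show ?thesis by (simp add: algebra_simps)
  qed
  then show ?thesis using assms by (simp add: cantor_copy_def)
qed

lemma cantor_copy_start: "cantor_copy (1 / 3) (2 / 3)"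
  using cantor_set_right_third by (simp add: cantor_copy_def)

lemma recip_length_bounds:
  fixes w a b :: real
  assumes "2 / 3 \<le> a" "a \<le> b" "b \<le> 1" "0 < w"
  shows "w * (b - a) \<le> w / a - w / b" "w / a - w / b \<le> 9 / 4 * (w * (b - a))"
proof -
  have eq: "w / a - w / b = w * (b - a) / (a * b)"
    using assms by (simp add: field_simps)
  have ab: "4 / 9 \<le> a * b" "a * b \<le> 1"
    using mult_mono[of "2/3" a "2/3" b] mult_mono[of a 1 b 1] assms by auto
  have nn: "0 \<le> w * (b - a)" using assms by simp
  show "w * (b - a) \<le> w / a - w / b"
    unfolding eq using mult_left_mono[OF ab(2) nn] ab(1) by (simp add: pos_le_divide_eq)
  show "w / a - w / b \<le> 9 / 4 * (w * (b - a))"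
    unfolding eq using mult_left_mono[OF ab(1) nn] ab(1) by (simp add: pos_divide_le_eq)
qed

text \<open>
  The remaining summands are known to fill \<open>[p, q]\<close>.  The image under \<open>y \<mapsto> w / y\<close> of the deleted
  middle third is no longer than \<open>q - p\<close>, so the sums of \<open>[p, q]\<close> with the images of the two
  outer thirds leave no gap between them and no target \<open>t\<close> is lost.
\<close>

lemma refine_summand:
  assumes a: "cantor_copy h a" and "0 < h" "0 < w" and gap: "3 / 4 * (w * h) \<le> q - p"
    and t: "w / (a + h) + p \<le> t" "t \<le> w / a + q"
  obtains a' where "cantor_copy (h / 3) a'" "w / (a' + h / 3) + p \<le> t" "t \<le> w / a' + q"
proof (cases "w / (a + h / 3) + p \<le> t")
  case True
  then show ?thesis using that[of a] cantor_copy_left[OF a] t by simp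
next
  case False
  have "w / (a + h / 3) - w / (a + 2 * h / 3) \<le> 3 / 4 * (w * h)"
    using recip_length_bounds(2)[of "a + h / 3" "a + 2 * h / 3" w] cantor_copyD[OF a] assms(2,3)
    by (simp add: mult.commute)
  then have "t \<le> w / (a + 2 * h / 3) + q" using False gap by linarith
  moreover have "a + 2 * h / 3 + h / 3 = a + h" by simp
  ultimately show ?thesis
    using that[of "a + 2 * h / 3"] cantor_copy_right[OF a] assms(2) t(1) by metis
qed

text \<open>
  Condition \<open>i\<close> on the weights lets summand \<open>i\<close> be refined when the order is
  \<open>w1, w2, w3, w4\<close>: an interval of length \<open>h\<close> has an image of length at
  least \<open>w * h\<close>, and for the summands already treated \<open>h\<close> has shrunk by a factor \<open>3\<close>.
\<close>

lemma refine_four_summands: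
  fixes w1 w2 w3 w4 :: real
  assumes w: "0 < w1" "0 < w2" "0 < w3" "0 < w4"
    and w1: "3 / 4 * w1 \<le> w2 + w3 + w4"
    and w2: "3 / 4 * w2 \<le> w1 / 3 + w3 + w4"
    and w3: "3 / 4 * w3 \<le> w1 / 3 + w2 / 3 + w4"
    and w4: "3 / 4 * w4 \<le> w1 / 3 + w2 / 3 + w3 / 3"
    and h: "0 < h"
    and copies: "cantor_copy h a" "cantor_copy h b" "cantor_copy h c" "cantor_copy h d"
    and t: "w1 / (a + h) + w2 / (b + h) + w3 / (c + h) + w4 / (d + h) \<le> t"
      "t \<le> w1 / a + w2 / b + w3 / c + w4 / d"
  obtains a' b' c' d' where
    "cantor_copy (h / 3) a'" "cantor_copy (h / 3) b'" "cantor_copy (h / 3) c'" "cantor_copy (h / 3) d'"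
    "w1 / (a' + h / 3) + w2 / (b' + h / 3) + w3 / (c' + h / 3) + w4 / (d' + h / 3) \<le> t"
    "t \<le> w1 / a' + w2 / b' + w3 / c' + w4 / d'"
proof -
  have len: "w * k \<le> w / x - w / (x + k)" if "cantor_copy k x" "0 < k" "0 < w" for w k x
    using recip_length_bounds(1)[of x "x + k" w] cantor_copyD[OF that(1)] that by simp
  have h3: "0 < h / 3" using h by simp
  have third: "w / 3 * h = w * (h / 3)" for w by simp
  note scale = mult_right_mono[OF _ less_imp_le[OF h]]
  have "3 / 4 * (w1 * h) \<le> (w2 / b + w3 / c + w4 / d) - (w2 / (b + h) + w3 / (c + h) + w4 / (d + h))"
    using scale[OF w1, unfolded distrib_right mult.assoc third] len[OF copies(2) h w(2)] len[OF copies(3) h w(3)] len[OF copies(4) h w(4)]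
    by linarith
  then obtain a' where a': "cantor_copy (h / 3) a'"
      "w1 / (a' + h / 3) + (w2 / (b + h) + w3 / (c + h) + w4 / (d + h)) \<le> t"
      "t \<le> w1 / a' + (w2 / b + w3 / c + w4 / d)"
    by (rule refine_summand[OF copies(1) h w(1), where t = t]) (use t in auto)
  have "3 / 4 * (w2 * h) \<le> (w1 / a' + w3 / c + w4 / d) - (w1 / (a' + h / 3) + w3 / (c + h) + w4 / (d + h))"
    using scale[OF w2, unfolded distrib_right mult.assoc third] len[OF a'(1) h3 w(1)] len[OF copies(3) h w(3)] len[OF copies(4) h w(4)]
    by linarith
  then obtain b' where b': "cantor_copy (h / 3) b'"
      "w2 / (b' + h / 3) + (w1 / (a' + h / 3) + w3 / (c + h) + w4 / (d + h)) \<le> t"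
      "t \<le> w2 / b' + (w1 / a' + w3 / c + w4 / d)"
    by (rule refine_summand[OF copies(2) h w(2), where t = t]) (use a' in auto)
  have "3 / 4 * (w3 * h) \<le> (w1 / a' + w2 / b' + w4 / d) - (w1 / (a' + h / 3) + w2 / (b' + h / 3) + w4 / (d + h))"
    using scale[OF w3, unfolded distrib_right mult.assoc third] len[OF a'(1) h3 w(1)] len[OF b'(1) h3 w(2)] len[OF copies(4) h w(4)]
    by linarith
  then obtain c' where c': "cantor_copy (h / 3) c'"
      "w3 / (c' + h / 3) + (w1 / (a' + h / 3) + w2 / (b' + h / 3) + w4 / (d + h)) \<le> t"
      "t \<le> w3 / c' + (w1 / a' + w2 / b' + w4 / d)"
    by (rule refine_summand[OF copies(3) h w(3), where t = t]) (use b' in auto)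
  have "3 / 4 * (w4 * h) \<le> (w1 / a' + w2 / b' + w3 / c') - (w1 / (a' + h / 3) + w2 / (b' + h / 3) + w3 / (c' + h / 3))"
    using scale[OF w4, unfolded distrib_right mult.assoc third] len[OF a'(1) h3 w(1)] len[OF b'(1) h3 w(2)] len[OF c'(1) h3 w(3)]
    by linarith
  then obtain d' where d': "cantor_copy (h / 3) d'"
      "w4 / (d' + h / 3) + (w1 / (a' + h / 3) + w2 / (b' + h / 3) + w3 / (c' + h / 3)) \<le> t"
      "t \<le> w4 / d' + (w1 / a' + w2 / b' + w3 / c')"
    by (rule refine_summand[OF copies(4) h w(4), where t = t]) (use c' in auto)
  show ?thesis using that[OF a'(1) b'(1) c'(1) d'(1)] d'(2,3) by simp
qed

text \<open>
  Iterating the refinement puts the target within any prescribed distance of a sum over left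
  endpoints, all of which belong to the Cantor set.  The set of all such sums is compact, hence
  contains the target.
\<close>

lemma weighted_recip_sum_full:
  fixes w1 w2 w3 w4 :: real
  assumes w: "0 < w1" "0 < w2" "0 < w3" "0 < w4"
    and weights: "3 / 4 * w1 \<le> w2 + w3 + w4"
      "3 / 4 * w2 \<le> w1 / 3 + w3 + w4"
      "3 / 4 * w3 \<le> w1 / 3 + w2 / 3 + w4"
      "3 / 4 * w4 \<le> w1 / 3 + w2 / 3 + w3 / 3"
    and t: "w1 + w2 + w3 + w4 \<le> t" "t \<le> 3 / 2 * (w1 + w2 + w3 + w4)"
  obtains a b c d where
    "a \<in> cantor_set - {0}" "b \<in> cantor_set - {0}" "c \<in> cantor_set - {0}" "d \<in> cantor_set - {0}"
    "t = w1 / a + w2 / b + w3 / c + w4 / d"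
proof -
  define R where "R = cantor_set \<inter> {2 / 3..}"
  define F where "F = (\<lambda>(a, b, c, d). w1 / a + w2 / b + w3 / c + w4 / d)"
  have stage: "\<exists>a b c d.
      cantor_copy ((1 / 3) ^ Suc n) a \<and> cantor_copy ((1 / 3) ^ Suc n) b \<and>
      cantor_copy ((1 / 3) ^ Suc n) c \<and> cantor_copy ((1 / 3) ^ Suc n) d \<and>
      w1 / (a + (1 / 3) ^ Suc n) + w2 / (b + (1 / 3) ^ Suc n) + w3 / (c + (1 / 3) ^ Suc n)
        + w4 / (d + (1 / 3) ^ Suc n) \<le> t \<and>
      t \<le> w1 / a + w2 / b + w3 / c + w4 / d" for n
  proof (induction n)
    case 0
    show ?case
      by (intro exI[of _ "2 / 3"]) (use cantor_copy_start t in simp)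
  next
    case (Suc n)
    define h :: real where "h = (1 / 3) ^ Suc n"
    have h: "0 < h" "(1 / 3) ^ Suc (Suc n) = h / 3" by (simp_all add: h_def)
    obtain a b c d where copies: "cantor_copy h a" "cantor_copy h b" "cantor_copy h c" "cantor_copy h d"
      and "w1 / (a + h) + w2 / (b + h) + w3 / (c + h) + w4 / (d + h) \<le> t"
        "t \<le> w1 / a + w2 / b + w3 / c + w4 / d"
      using Suc.IH unfolding h_def by blast
    from refine_four_summands[OF w weights h(1) this] show ?case
      unfolding h(2) by metis
  qed
  have "compact (F ` (R \<times> R \<times> R \<times> R))"
    unfolding F_def R_def case_prod_unfold
    by (intro compact_continuous_image compact_Times compact_Int_closed compact_cantor_set
        closed_atLeast continuous_intros) auto
  moreover have "\<exists>y\<in>F ` (R \<times> R \<times> R \<times> R). dist y t < e" if "0 < e" for e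
  proof -
    define W where "W = 9 / 4 * (w1 + w2 + w3 + w4)"
    have "0 < W" using w by (simp add: W_def)
    then have "0 < e / W" using that by simp
    then obtain n where "(1 / 3) ^ n < e / W"
      using real_arch_pow_inv[of "e / W" "1 / 3"] by auto
    define h :: real where "h = (1 / 3) ^ Suc n"
    have h: "0 < h" by (simp add: h_def)
    have "h < e / W" using \<open>(1 / 3) ^ n < e / W\<close> zero_less_power[of "1/3::real" n]
      unfolding h_def power_Suc by linarith
    then have small: "W * h < e" using \<open>0 < W\<close> by (simp add: field_simps)
    obtain a b c d where copies: "cantor_copy h a" "cantor_copy h b" "cantor_copy h c" "cantor_copy h d"
      and bounds: "w1 / (a + h) + w2 / (b + h) + w3 / (c + h) + w4 / (d + h) \<le> t"
        "t \<le> w1 / a + w2 / b + w3 / c + w4 / d"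
      using stage[of n] unfolding h_def by blast
    have len: "w / x - w / (x + h) \<le> 9 / 4 * (w * h)" if "cantor_copy h x" "0 < w" for w x
      using recip_length_bounds(2)[of x "x + h" w] cantor_copyD[OF that(1)] that h by simp
    have "W * h = 9 / 4 * (w1 * h) + 9 / 4 * (w2 * h) + 9 / 4 * (w3 * h) + 9 / 4 * (w4 * h)"
      by (simp add: W_def algebra_simps)
    then have "w1 / a + w2 / b + w3 / c + w4 / d - t \<le> W * h"
      using bounds(1) len[OF copies(1) w(1)] len[OF copies(2) w(2)] len[OF copies(3) w(3)]
        len[OF copies(4) w(4)] by linarith
    then have "dist (F (a, b, c, d)) t < e" using bounds(2) small by (simp add: F_def dist_real_def)
    moreover have "(a, b, c, d) \<in> R \<times> R \<times> R \<times> R" using copies cantor_copyD by (simp add: R_def)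
    ultimately show ?thesis by blast
  qed
  ultimately have "t \<in> F ` (R \<times> R \<times> R \<times> R)"
    using closed_approachable compact_imp_closed by blast
  then obtain a b c d where abcd: "a \<in> R" "b \<in> R" "c \<in> R" "d \<in> R"
    "t = w1 / a + w2 / b + w3 / c + w4 / d" by (auto simp: F_def)
  have "R \<subseteq> cantor_set - {0}" by (auto simp: R_def)
  then show ?thesis using that[of a b c d] abcd by blast
qed

section \<open>The fourfold sum\<close>

lemma exists_power_3_bracket:
  fixes t :: real assumes "4 \<le> t"
  obtains n where "4 * 3 ^ n \<le> t" "t < 12 * 3 ^ n"
proof -
  define P where "P n \<longleftrightarrow> t < 12 * 3 ^ n" for n
  obtain m where "t < 3 ^ m" using real_arch_pow[of 3 t] by auto
  then have "P m" using zero_less_power[of "3::real" m] unfolding P_def by linarith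
  define n where "n = (LEAST n. P n)"
  have "P n" unfolding n_def using \<open>P m\<close> by (rule LeastI)
  moreover have "4 * 3 ^ n \<le> t"
  proof (cases n)
    case (Suc k)
    then have "\<not> P k" using not_less_Least[of k P] by (simp add: n_def)
    then show ?thesis by (simp add: P_def Suc)
  qed (use assms in simp)
  ultimately show ?thesis using that by (simp add: P_def)
qed

lemma sum_of_four_recips:
  fixes t :: real assumes "4 \<le> t"
  shows "\<exists>x1\<in>cantor_set - {0}. \<exists>x2\<in>cantor_set - {0}. \<exists>x3\<in>cantor_set - {0}. \<exists>x4\<in>cantor_set - {0}.
    t = 1 / x1 + 1 / x2 + 1 / x3 + 1 / x4"
proof -
  obtain n where n: "4 * 3 ^ n \<le> t" "t < 12 * 3 ^ n"
    using exists_power_3_bracket[OF assms] .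
  define s where "s = t / 3 ^ n"
  have s: "4 \<le> s" "s < 12" using n by (simp_all add: s_def field_simps)
  \<comment> \<open>The weights and the common factor are powers of \<open>3\<close>, so the summands absorb them.\<close>
  have rescale: ?thesis
    if abcd: "a \<in> cantor_set - {0}" "b \<in> cantor_set - {0}" "c \<in> cantor_set - {0}" "d \<in> cantor_set - {0}"
      and sum: "s = 3 ^ i / a + 3 ^ j / b + 1 / c + 1 / d" for a b c d i j
  proof (intro bexI)
    have "t = 3 ^ n * (3 ^ i / a + 3 ^ j / b + 1 / c + 1 / d)" by (simp add: s_def flip: sum)
    then show "t = 1 / (a / 3 ^ (n + i)) + 1 / (b / 3 ^ (n + j)) + 1 / (c / 3 ^ n) + 1 / (d / 3 ^ n)"
      by (simp add: power_add distrib_left)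
  qed (use abcd cantor_set_div_power_3 in simp_all)
  consider "s \<le> 6" | "6 \<le> s" "s \<le> 9" | "9 \<le> s" by linarith
  then show ?thesis
  proof cases
    case 1
    show ?thesis
      by (rule weighted_recip_sum_full[of 1 1 1 1 s]) (use 1 s rescale[of _ _ _ _ 0 0] in simp_all)
  next
    case 2
    show ?thesis
      by (rule weighted_recip_sum_full[of 3 1 1 1 s]) (use 2 rescale[of _ _ _ _ 1 0] in simp_all)
  next
    case 3
    show ?thesis
      by (rule weighted_recip_sum_full[of 3 3 1 1 s]) (use 3 s rescale[of _ _ _ _ 1 1] in simp_all)
  qed
qed

lemma recip_sumset_4_eq:
  "recip_sumset 4 S = {1 / x1 + 1 / x2 + 1 / x3 + 1 / x4 | x1 x2 x3 x4 :: real.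
     x1 \<in> S - {0} \<and> x2 \<in> S - {0} \<and> x3 \<in> S - {0} \<and> x4 \<in> S - {0}}" (is "_ = ?T")
proof
  have sum4: "(\<Sum>i<4. f i) = f 0 + f 1 + f 2 + f 3" for f :: "nat \<Rightarrow> real"
    by (simp add: numeral_eq_Suc)
  show "recip_sumset 4 S \<subseteq> ?T"
  proof
    fix t assume "t \<in> recip_sumset 4 S"
    then obtain x :: "nat \<Rightarrow> real" where "\<forall>i<4. x i \<in> S - {0}" "t = 1 / x 0 + 1 / x 1 + 1 / x 2 + 1 / x 3"
      unfolding recip_sumset_def sum4 by blast
    then show "t \<in> ?T" by (intro CollectI exI[of _ "x _"]) auto
  qed
  show "?T \<subseteq> recip_sumset 4 S"
  proof
    fix t assume "t \<in> ?T"
    then obtain x1 x2 x3 x4 where x: "x1 \<in> S - {0}" "x2 \<in> S - {0}" "x3 \<in> S - {0}" "x4 \<in> S - {0}"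
      and t: "t = 1 / x1 + 1 / x2 + 1 / x3 + 1 / x4" by blast
    define f where "f = (!) [x1, x2, x3, x4]"
    have "\<forall>i<4. f i \<in> S - {0}"
      using x by (auto simp: f_def less_Suc_eq numeral_eq_Suc)
    moreover have "t = (\<Sum>i<4. 1 / f i)"
      unfolding sum4 t by (simp add: f_def)
    ultimately show "t \<in> recip_sumset 4 S" unfolding recip_sumset_def by blast
  qed
qed

section \<open>Fewer than four summands\<close>

lemma recip_cantor_ge_1: "x \<in> cantor_set - {0} \<Longrightarrow> 1 \<le> 1 / x"
  using cantor_set_bounds[of x] by auto

lemma recip_sumset_cantor_ge:
  assumes "t \<in> recip_sumset m cantor_set" shows "real m \<le> t"
proof -
  obtain x where x: "\<forall>i<m. x i \<in> cantor_set - {0}" and t: "t = (\<Sum>i<m. 1 / x i)"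
    using assms by (auto simp: recip_sumset_def)
  have "(\<Sum>i<m. 1) \<le> (\<Sum>i<m. 1 / x i)"
    using x by (intro sum_mono recip_cantor_ge_1) auto
  then show ?thesis by (simp add: t)
qed

text \<open>
  The middle third \<open>(1/3, 2/3)\<close> missing from the Cantor set keeps each reciprocal out of
  \<open>(3/2, 3)\<close>; a single summand that is at least \<open>3\<close> pushes the sum up to \<open>m + 2\<close>.
\<close>

lemma recip_sumset_cantor_gap:
  assumes "t \<in> recip_sumset m cantor_set" shows "t \<le> 3 / 2 * real m \<or> real m + 2 \<le> t"
proof -
  obtain x where x: "\<forall>i<m. x i \<in> cantor_set - {0}" and t: "t = (\<Sum>i<m. 1 / x i)"
    using assms by (auto simp: recip_sumset_def)
  show ?thesis
  proof (cases "\<forall>i<m. 2 / 3 \<le> x i")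
    case True
    have "(\<Sum>i<m. 1 / x i) \<le> (\<Sum>i<m. 3 / 2)"
    proof (rule sum_mono)
      fix i assume "i \<in> {..<m}"
      then have "2 / 3 \<le> x i" using True by simp
      then show "1 / x i \<le> 3 / 2" by (simp add: field_simps)
    qed
    then show ?thesis by (simp add: t)
  next
    case False
    then obtain k where k: "k < m" "x k \<le> 1 / 3"
      using x cantor_set_gap by blast
    have "0 < x k" using k x cantor_set_bounds[of "x k"] by auto
    then have big: "3 \<le> 1 / x k" using k by (simp add: field_simps)
    have "(\<Sum>i<m. 1 + (if i = k then 2 else 0)) \<le> (\<Sum>i<m. 1 / x i)"
      using x big recip_cantor_ge_1 by (intro sum_mono) auto
    moreover have "(\<Sum>i<m. 1 + (if i = k then 2 else (0::real))) = real m + 2"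
      using k by (simp add: sum.distrib)
    ultimately show ?thesis by (simp add: t)
  qed
qed

lemma recip_sumset_cantor_not_interval:
  assumes "0 < m" "m < 4" shows "\<not> is_interval (recip_sumset m cantor_set)"
proof
  assume interval: "is_interval (recip_sumset m cantor_set)"
  have third: "1 / 3 \<in> cantor_set" using cantor_set_left_third[OF one_in_cantor_set] .
  have "real m \<in> recip_sumset m cantor_set"
    unfolding recip_sumset_def using one_in_cantor_set
    by (intro CollectI exI[of _ "\<lambda>_. 1"]) auto
  moreover have "real m + 2 \<in> recip_sumset m cantor_set"
  proof -
    define x :: "nat \<Rightarrow> real" where "x i = (if i = 0 then 1 / 3 else 1)" for i
    have "(\<Sum>i<m. 1 / x i) = (\<Sum>i<m. 1 + (if i = 0 then 2 else 0))"
      by (intro sum.cong) (auto simp: x_def)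
    also have "\<dots> = real m + 2" using assms by (simp add: sum.distrib)
    finally show ?thesis
      unfolding recip_sumset_def using third one_in_cantor_set
      by (intro CollectI exI[of _ x]) (auto simp: x_def)
  qed
  \<comment> \<open>The midpoint of \<open>3 m / 2\<close> and \<open>m + 2\<close>.\<close>
  ultimately have "5 / 4 * real m + 1 \<in> recip_sumset m cantor_set"
    using interval assms unfolding is_interval_1 by fastforce
  then show False using recip_sumset_cantor_gap assms by fastforce
qed

section \<open>The threshold four\<close>

theorem theorem3p4:
  shows "recip_sumset 4 cantor_set =
           {1 / x1 + 1 / x2 + 1 / x3 + 1 / x4 | x1 x2 x3 x4 :: real.
              x1 \<in> cantor_set - {0} \<and> x2 \<in> cantor_set - {0} \<and>
              x3 \<in> cantor_set - {0} \<and> x4 \<in> cantor_set - {0}}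
       \<and> recip_sumset 4 cantor_set = {4..}
       \<and> (\<forall>a\<in>{4..}. \<exists>x1\<in>cantor_set - {0}. \<exists>x2\<in>cantor_set - {0}.
            \<exists>x3\<in>cantor_set - {0}. \<exists>x4\<in>cantor_set - {0}.
              a = 1 / x1 + 1 / x2 + 1 / x3 + 1 / x4)
       \<and> \<not> is_interval (recip_sumset 3 cantor_set)
       \<and> \<not> is_interval (recip_sumset 2 cantor_set)"
proof (intro conjI)
  show "recip_sumset 4 cantor_set = {4..}"
  proof
    show "recip_sumset 4 cantor_set \<subseteq> {4..}"
      using recip_sumset_cantor_ge[of _ 4] by auto
    show "{4..} \<subseteq> recip_sumset 4 cantor_set"
      unfolding recip_sumset_4_eq using sum_of_four_recips by fastforce
  qed
  show "\<forall>a\<in>{4..}. \<exists>x1\<in>cantor_set - {0}. \<exists>x2\<in>cantor_set - {0}.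
      \<exists>x3\<in>cantor_set - {0}. \<exists>x4\<in>cantor_set - {0}. a = 1 / x1 + 1 / x2 + 1 / x3 + 1 / x4"
    using sum_of_four_recips by simp
qed (rule recip_sumset_4_eq recip_sumset_cantor_not_interval; simp)+

end
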